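(* Let $S$ be a semigroup and $\varrho$ a congruence on $S$. Then $\varrho$ is a left equalizer simple congruence on $S$ if and only if $\varrho^*$ is a left cancellative congruence on $S$.
   Context: For a congruence $\varrho$ on a semigroup $S$, $\varrho^*$ denotes the congruence on $S$ defined by: $(a,b)\in\varrho^*$ if and only if $(xa,xb)\in\varrho$ for all $x\in S$. A congruence $\varrho$ on $S$ is called left equalizer simple if the factor semigroup $S/\varrho$ is left equalizer simple, that is, if for all $a,b\in S$, $(x_0a,x_0b)\in\varrho$ for some $x_0\in S$ implies $(xa,xb)\in\varrho$ for all $x\in S$. A congruence $\varrho$ on $S$ is called left cancellative if $S/\varrho$ is a left cancellative semigroup, that is, if for all $a,b\in S$, $(x_0a,x_0b)\in\varrho$ for some $x_0\in S$ implies $(a,b)\in\varrho$. *)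

theory Defs
  imports Main
begin

locale semigroup_on =
  fixes S :: "'a set" and mul :: "'a \<Rightarrow> 'a \<Rightarrow> 'a"
  assumes closed: "\<lbrakk>a \<in> S; b \<in> S\<rbrakk> \<Longrightarrow> mul a b \<in> S"
    and assoc: "\<lbrakk>a \<in> S; b \<in> S; c \<in> S\<rbrakk> \<Longrightarrow> mul (mul a b) c = mul a (mul b c)"

locale left_equalizer_simple_semigroup = semigroup_on +
  assumes equalize:
    "\<lbrakk>a \<in> S; b \<in> S; x\<^sub>0 \<in> S; mul x\<^sub>0 a = mul x\<^sub>0 b; x \<in> S\<rbrakk> \<Longrightarrow> mul x a = mul x b"

locale left_cancellative_semigroup = semigroup_on +
  assumes left_cancel:
    "\<lbrakk>a \<in> S; b \<in> S; x\<^sub>0 \<in> S; mul x\<^sub>0 a = mul x\<^sub>0 b\<rbrakk> \<Longrightarrow> a = b"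

definition semigroup_congruence :: "'a set \<Rightarrow> ('a \<Rightarrow> 'a \<Rightarrow> 'a) \<Rightarrow> ('a \<times> 'a) set \<Rightarrow> bool" where
  "semigroup_congruence S mul \<rho> \<longleftrightarrow>
     equiv S \<rho> \<and>
     (\<forall>a b c d. (a, b) \<in> \<rho> \<longrightarrow> (c, d) \<in> \<rho> \<longrightarrow> (mul a c, mul b d) \<in> \<rho>)"

text \<open>
  The factor semigroup has carrier \<^term>\<open>S // \<rho>\<close>. The union below ranges over all choices of
  representatives; if \<open>\<rho>\<close> is a congruence, every choice contributes the same class
  (see \<open>factor_mul_class\<close>).
\<close>
definition factor_mul ::
  "('a \<Rightarrow> 'a \<Rightarrow> 'a) \<Rightarrow> ('a \<times> 'a) set \<Rightarrow> 'a set \<Rightarrow> 'a set \<Rightarrow> 'a set" where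
  "factor_mul mul \<rho> A B = (\<Union>a\<in>A. \<Union>b\<in>B. \<rho> `` {mul a b})"

definition left_equalizer_simple_congruence ::
  "'a set \<Rightarrow> ('a \<Rightarrow> 'a \<Rightarrow> 'a) \<Rightarrow> ('a \<times> 'a) set \<Rightarrow> bool" where
  "left_equalizer_simple_congruence S mul \<rho> \<longleftrightarrow>
     semigroup_congruence S mul \<rho> \<and>
     left_equalizer_simple_semigroup (S // \<rho>) (factor_mul mul \<rho>)"

definition left_cancellative_congruence ::
  "'a set \<Rightarrow> ('a \<Rightarrow> 'a \<Rightarrow> 'a) \<Rightarrow> ('a \<times> 'a) set \<Rightarrow> bool" where
  "left_cancellative_congruence S mul \<rho> \<longleftrightarrow>
     semigroup_congruence S mul \<rho> \<and>
     left_cancellative_semigroup (S // \<rho>) (factor_mul mul \<rho>)"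

definition star_congruence ::
  "'a set \<Rightarrow> ('a \<Rightarrow> 'a \<Rightarrow> 'a) \<Rightarrow> ('a \<times> 'a) set \<Rightarrow> ('a \<times> 'a) set" where
  "star_congruence S mul \<rho> =
     {(a, b). a \<in> S \<and> b \<in> S \<and> (\<forall>x\<in>S. (mul x a, mul x b) \<in> \<rho>)}"

lemma factor_mul_class:
  assumes "semigroup_congruence S mul \<rho>" "a \<in> S" "b \<in> S"
  shows "factor_mul mul \<rho> (\<rho> `` {a}) (\<rho> `` {b}) = \<rho> `` {mul a b}"
proof -
  have eq: "equiv S \<rho>"
    and comp: "\<And>a b c d. (a, b) \<in> \<rho> \<Longrightarrow> (c, d) \<in> \<rho> \<Longrightarrow> (mul a c, mul b d) \<in> \<rho>"
    using assms(1) unfolding semigroup_congruence_def by blast+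
  have "congruent2 \<rho> \<rho> (\<lambda>a b. \<rho> `` {mul a b})"
    by (intro congruent2I' equiv_class_eq[OF eq] comp)
  then show ?thesis
    unfolding factor_mul_def using UN_equiv_class2[OF eq eq] assms(2,3) by blast
qed

lemma factor_semigroup:
  assumes "semigroup_on S mul" "semigroup_congruence S mul \<rho>"
  shows "semigroup_on (S // \<rho>) (factor_mul mul \<rho>)"
proof -
  interpret semigroup_on S mul by fact
  show ?thesis
    by standard (auto elim!: quotientE simp: factor_mul_class[OF assms(2)] closed assoc
        intro!: quotientI)
qed

lemma factor_mul_eq_iff:
  assumes "semigroup_on S mul" "semigroup_congruence S mul \<rho>" "a \<in> S" "b \<in> S" "x \<in> S"
  shows "factor_mul mul \<rho> (\<rho> `` {x}) (\<rho> `` {a}) = factor_mul mul \<rho> (\<rho> `` {x}) (\<rho> `` {b})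
           \<longleftrightarrow> (mul x a, mul x b) \<in> \<rho>"
proof -
  have "equiv S \<rho>" using assms(2) unfolding semigroup_congruence_def by blast
  then show ?thesis
    using assms semigroup_on.closed[OF assms(1)]
    by (simp add: factor_mul_class[OF assms(2)] eq_equiv_class_iff)
qed

lemma left_equalizer_simple_congruence_iff:
  assumes "semigroup_on S mul" "semigroup_congruence S mul \<rho>"
  shows "left_equalizer_simple_congruence S mul \<rho> \<longleftrightarrow>
    (\<forall>a\<in>S. \<forall>b\<in>S. (\<exists>x\<^sub>0\<in>S. (mul x\<^sub>0 a, mul x\<^sub>0 b) \<in> \<rho>) \<longrightarrow> (\<forall>x\<in>S. (mul x a, mul x b) \<in> \<rho>))"
    (is "_ \<longleftrightarrow> ?R")
proof -
  have "left_equalizer_simple_congruence S mul \<rho> \<longleftrightarrow>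
    (\<forall>A\<in>S // \<rho>. \<forall>B\<in>S // \<rho>. \<forall>X0\<in>S // \<rho>. \<forall>X\<in>S // \<rho>.
       factor_mul mul \<rho> X0 A = factor_mul mul \<rho> X0 B \<longrightarrow>
       factor_mul mul \<rho> X A = factor_mul mul \<rho> X B)"
    unfolding left_equalizer_simple_congruence_def left_equalizer_simple_semigroup_def
      left_equalizer_simple_semigroup_axioms_def
    using factor_semigroup[OF assms] assms(2) by blast
  also have "\<dots> \<longleftrightarrow> ?R"
    unfolding quotient_def using factor_mul_eq_iff[OF assms] by simp
  finally show ?thesis .
qed

lemma left_cancellative_congruence_iff:
  assumes "semigroup_on S mul" "semigroup_congruence S mul \<rho>"
  shows "left_cancellative_congruence S mul \<rho> \<longleftrightarrow>
    (\<forall>a\<in>S. \<forall>b\<in>S. (\<exists>x\<^sub>0\<in>S. (mul x\<^sub>0 a, mul x\<^sub>0 b) \<in> \<rho>) \<longrightarrow> (a, b) \<in> \<rho>)"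
    (is "_ \<longleftrightarrow> ?R")
proof -
  have eq: "equiv S \<rho>" using assms(2) unfolding semigroup_congruence_def by blast
  have "left_cancellative_congruence S mul \<rho> \<longleftrightarrow>
    (\<forall>A\<in>S // \<rho>. \<forall>B\<in>S // \<rho>. \<forall>X0\<in>S // \<rho>.
       factor_mul mul \<rho> X0 A = factor_mul mul \<rho> X0 B \<longrightarrow> A = B)"
    unfolding left_cancellative_congruence_def left_cancellative_semigroup_def
      left_cancellative_semigroup_axioms_def
    using factor_semigroup[OF assms] assms(2) by blast
  also have "\<dots> \<longleftrightarrow> ?R"
    unfolding quotient_def
    using factor_mul_eq_iff[OF assms] eq_equiv_class_iff[OF eq] by simp
  finally show ?thesis .
qed

lemma star_congruence_is_congruence:
  assumes "semigroup_on S mul" "semigroup_congruence S mul \<rho>"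
  shows "semigroup_congruence S mul (star_congruence S mul \<rho>)"
proof -
  interpret semigroup_on S mul by fact
  have eq: "equiv S \<rho>"
    and comp: "\<And>a b c d. (a, b) \<in> \<rho> \<Longrightarrow> (c, d) \<in> \<rho> \<Longrightarrow> (mul a c, mul b d) \<in> \<rho>"
    using assms(2) unfolding semigroup_congruence_def by blast+
  have r: "(a, a) \<in> \<rho>" if "a \<in> S" for a using eq that by (meson equivE refl_onD)
  have s: "(b, a) \<in> \<rho>" if "(a, b) \<in> \<rho>" for a b using eq that by (meson equivE symD)
  have t: "(a, c) \<in> \<rho>" if "(a, b) \<in> \<rho>" "(b, c) \<in> \<rho>" for a b c
    using eq that by (meson equivE transD)
  have "equiv S (star_congruence S mul \<rho>)"
    by (intro equivI refl_onI symI transI)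
      (auto simp: star_congruence_def closed intro: r s t)
  moreover have "(mul x (mul a c), mul x (mul b d)) \<in> \<rho>"
    if "(a, b) \<in> star_congruence S mul \<rho>" "(c, d) \<in> star_congruence S mul \<rho>" "x \<in> S"
    for a b c d x
  proof -
    have S: "a \<in> S" "b \<in> S" "c \<in> S" "d \<in> S"
      and ab: "(mul x a, mul x b) \<in> \<rho>" and cd: "(mul (mul x b) c, mul (mul x b) d) \<in> \<rho>"
      using that closed by (auto simp: star_congruence_def)
    from t[OF comp[OF ab r[OF S(3)]] cd] show ?thesis
      using S that(3) by (simp add: assoc)
  qed
  ultimately show ?thesis
    unfolding semigroup_congruence_def
    by (auto simp: star_congruence_def closed)
qed

end

theory Submission
  imports Defs
begin

text \<open>On representatives (\<open>left_equalizer_simple_congruence_iff\<close>,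
  \<open>left_cancellative_congruence_iff\<close>), both properties conclude that a, b are related
  by the star of \<rho>, from one left multiple pair. They differ only in the premise: that pair
  lies in \<rho> for the former, in its star for the latter. Since \<rho> is contained in its star,
  cancellativity gives equalizer simplicity; conversely, one more left multiplication brings a pair
  of the star back into \<rho>.\<close>

theorem theorem3p1:
  fixes S :: "'a set" and mul :: "'a \<Rightarrow> 'a \<Rightarrow> 'a" and \<rho> :: "('a \<times> 'a) set"
  assumes "semigroup_on S mul"
    and "semigroup_congruence S mul \<rho>"
  shows "left_equalizer_simple_congruence S mul \<rho> \<longleftrightarrow>
         left_cancellative_congruence S mul (star_congruence S mul \<rho>)"
proof -
  interpret semigroup_on S mul by fact
  let ?star = "star_congruence S mul \<rho>"
  have refl: "(x, x) \<in> \<rho>" if "x \<in> S" for x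
    using assms(2) that unfolding semigroup_congruence_def by (meson equivE refl_onD)
  have comp: "(mul x a, mul x b) \<in> \<rho>" if "x \<in> S" "(a, b) \<in> \<rho>" for x a b
    using assms(2) refl that unfolding semigroup_congruence_def by blast
  note les = left_equalizer_simple_congruence_iff[OF assms]
  note lc = left_cancellative_congruence_iff
      [OF assms(1) star_congruence_is_congruence[OF assms]]
  show ?thesis
  proof
    assume L: "left_equalizer_simple_congruence S mul \<rho>"
    have "(a, b) \<in> ?star"
      if S: "a \<in> S" "b \<in> S" "x\<^sub>0 \<in> S" and star: "(mul x\<^sub>0 a, mul x\<^sub>0 b) \<in> ?star" for a b x\<^sub>0
    proof -
      \<comment> \<open>Any element of S could serve as the outer multiplier;
        \<open>x\<^sub>0\<close> is at hand.\<close>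
      have "(mul (mul x\<^sub>0 x\<^sub>0) a, mul (mul x\<^sub>0 x\<^sub>0) b) \<in> \<rho>"
        using star S by (simp add: star_congruence_def assoc)
      moreover have "mul x\<^sub>0 x\<^sub>0 \<in> S"
        using S closed by blast
      ultimately have "\<forall>x\<in>S. (mul x a, mul x b) \<in> \<rho>"
        using L S unfolding les by blast
      then show ?thesis
        using S by (simp add: star_congruence_def)
    qed
    then show "left_cancellative_congruence S mul ?star"
      unfolding lc by blast
  next
    assume C: "left_cancellative_congruence S mul ?star"
    have "(mul x a, mul x b) \<in> \<rho>"
      if S: "a \<in> S" "b \<in> S" "x\<^sub>0 \<in> S" "x \<in> S" and "(mul x\<^sub>0 a, mul x\<^sub>0 b) \<in> \<rho>" for a b x\<^sub>0 x
    proof -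
      \<comment> \<open>Left compatibility of \<rho> puts \<rho> inside its star.\<close>
      have "(mul x\<^sub>0 a, mul x\<^sub>0 b) \<in> ?star"
        using that comp closed by (simp add: star_congruence_def)
      then have "(a, b) \<in> ?star"
        using C S unfolding lc by blast
      then show ?thesis
        using S by (simp add: star_congruence_def)
    qed
    then show "left_equalizer_simple_congruence S mul \<rho>"
      unfolding les by blast
  qed
qed

end
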